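(* Let $A$ be a unital $C^*$-algebra, $m\ge1$, $\alpha:\mathbb{Z}^m\to\mathrm{Aut}(A)$ a group action, and $B$ an $\alpha$-invariant $C^*$-subalgebra of $A$ with $1_A\in B$. Suppose the action is asymptotically commutative, in the sense that for any $\varepsilon>0$ and any finite subset $F\subseteq A$ there exists $u\in\mathbb{Z}^m$ such that $\|[\alpha^u(x),y]\|<\varepsilon$ for all $x,y\in F$. Then $\dim_{\mathrm{Rok}}(\alpha)\le\dim_{\mathrm{Rok}}(\alpha|_B)$.
   Context: $\alpha^v:=\alpha(v)$, and $\alpha|_B$ is the restricted action on $B$. Rokhlin dimension of an action $\alpha$ of $\mathbb{Z}^m$ on a unital $C^*$-algebra $A$: for $n\in\mathbb{N}$ let $B_n=\{0,1,\dots,n-1\}^m\subseteq\mathbb{Z}^m$; $v+w \bmod n\mathbb{Z}^m$ denotes the representative in $B_n$. We write $\dim_{\mathrm{Rok}}(\alpha)\le d$ if for any finite subset $F\subseteq A$, $\varepsilon>0$ and $n\in\mathbb{N}$ there exist positive contractions $(f_v^{(\ell)})_{v\in B_n}^{\ell=0,\dots,d}$ in $A$ such that: (1) $\|\alpha^w(f_v^{(\ell)})-f^{(\ell)}_{(v+w \bmod n\mathbb{Z}^m)}\|<\varepsilon$ for $0\le\ell\le d$, $v\in B_n$, $w\in\mathbb{Z}^m$; (2) $\|f_v^{(\ell)}f_{v'}^{(\ell)}\|<\varepsilon$ for $0\le \ell\le d$ and $v\ne v'$ in $B_n$; (3) $\|[f_v^{(\ell)},a]\|<\varepsilon$ for all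 $\ell$, $v\in B_n$, $a\in F$; (4) $\|\sum_{\ell=0}^d\sum_{v\in B_n}f_v^{(\ell)}-1_A\|<\varepsilon$. $\dim_{\mathrm{Rok}}(\alpha)$ is the least such $d$, or $\infty$ if there is none. *)

theory Defs
  imports "HOL-Analysis.Analysis" "HOL-Library.Extended_Nat"
begin

text \<open>
  The class \<open>banach\<close> only provides real scalars; \<open>scaleC\<close> adds a compatible complex structure.
\<close>

class cstar_algebra = banach + real_normed_algebra +
  fixes scaleC :: "complex \<Rightarrow> 'a \<Rightarrow> 'a"
    and star :: "'a \<Rightarrow> 'a"
  assumes scaleC_add_right: "scaleC c (x + y) = scaleC c x + scaleC c y"
    and scaleC_add_left: "scaleC (c + d) x = scaleC c x + scaleC d x"
    and scaleC_scaleC: "scaleC c (scaleC d x) = scaleC (c * d) x"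
    and scaleC_one: "scaleC 1 x = x"
    and scaleC_of_real: "scaleC (complex_of_real r) x = r *\<^sub>R x"
    and mult_scaleC_left: "scaleC c x * y = scaleC c (x * y)"
    and mult_scaleC_right: "x * scaleC c y = scaleC c (x * y)"
    and norm_scaleC: "norm (scaleC c x) = cmod c * norm x"
    and star_add: "star (x + y) = star x + star y"
    and star_scaleC: "star (scaleC c x) = scaleC (cnj c) (star x)"
    and star_mult: "star (x * y) = star y * star x"
    and star_star: "star (star x) = x"
    and cstar_identity: "norm (star x * x) = (norm x)\<^sup>2"

text \<open>
  The unit is added through \<open>monoid_mult\<close> rather than \<open>ring_1\<close> or
  \<open>real_normed_algebra_1\<close>, so that the zero algebra is not excluded.
\<close>

class unital_cstar_algebra = cstar_algebra + monoid_mult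

definition cstar_subalgebra :: "'a::cstar_algebra set \<Rightarrow> bool" where
  "cstar_subalgebra B \<longleftrightarrow>
     0 \<in> B \<and>
     (\<forall>x\<in>B. \<forall>y\<in>B. x + y \<in> B) \<and>
     (\<forall>c. \<forall>x\<in>B. scaleC c x \<in> B) \<and>
     (\<forall>x\<in>B. \<forall>y\<in>B. x * y \<in> B) \<and>
     (\<forall>x\<in>B. star x \<in> B) \<and>
     closed B"

definition star_automorphism :: "('a::cstar_algebra \<Rightarrow> 'a) \<Rightarrow> bool" where
  "star_automorphism \<phi> \<longleftrightarrow>
     bij \<phi> \<and>
     (\<forall>x y. \<phi> (x + y) = \<phi> x + \<phi> y) \<and>
     (\<forall>c x. \<phi> (scaleC c x) = scaleC c (\<phi> x)) \<and>
     (\<forall>x y. \<phi> (x * y) = \<phi> x * \<phi> y) \<and>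
     (\<forall>x. \<phi> (star x) = star (\<phi> x))"

text \<open>The group Z^m is \<open>int ^ 'm\<close> with m = \<open>CARD('m)\<close>.\<close>

definition zm_action :: "(int ^ 'm \<Rightarrow> 'a::cstar_algebra \<Rightarrow> 'a) \<Rightarrow> bool" where
  "zm_action \<alpha> \<longleftrightarrow>
     (\<forall>v. star_automorphism (\<alpha> v)) \<and>
     \<alpha> 0 = id \<and>
     (\<forall>v w. \<alpha> (v + w) = \<alpha> v \<circ> \<alpha> w)"

definition invariant_under :: "(int ^ 'm \<Rightarrow> 'a \<Rightarrow> 'a) \<Rightarrow> 'a set \<Rightarrow> bool" where
  "invariant_under \<alpha> B \<longleftrightarrow> (\<forall>v. \<alpha> v ` B \<subseteq> B)"

definition restricted_action :: "(int ^ 'm \<Rightarrow> 'a \<Rightarrow> 'a) \<Rightarrow> 'a set \<Rightarrow> int ^ 'm \<Rightarrow> 'a \<Rightarrow> 'a" where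
  "restricted_action \<alpha> B v = restrict (\<alpha> v) B"

definition commutator :: "'a::ring \<Rightarrow> 'a \<Rightarrow> 'a" where
  "commutator x y = x * y - y * x"

definition asymptotically_commutative :: "(int ^ 'm \<Rightarrow> 'a::cstar_algebra \<Rightarrow> 'a) \<Rightarrow> bool" where
  "asymptotically_commutative \<alpha> \<longleftrightarrow>
     (\<forall>\<epsilon>>0. \<forall>F. finite F \<longrightarrow>
        (\<exists>u. \<forall>x\<in>F. \<forall>y\<in>F. norm (commutator (\<alpha> u x) y) < \<epsilon>))"

definition rokhlin_box :: "nat \<Rightarrow> (int ^ 'm) set" where
  "rokhlin_box n = {v. \<forall>i. 0 \<le> v $ i \<and> v $ i < int n}"

definition vec_mod :: "int ^ 'm \<Rightarrow> nat \<Rightarrow> int ^ 'm" where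
  "vec_mod v n = (\<chi> i. v $ i mod int n)"

text \<open>
  The first argument \<open>S\<close> of the following notions is the algebra acted upon, given as a
  C*-subalgebra of the ambient type containing its unit (\<open>UNIV\<close> for the whole algebra).
  Positivity is taken inside \<open>S\<close>.
\<close>

definition positive_contraction_in :: "'a::cstar_algebra set \<Rightarrow> 'a \<Rightarrow> bool" where
  "positive_contraction_in S f \<longleftrightarrow> f \<in> S \<and> (\<exists>g\<in>S. f = star g * g) \<and> norm f \<le> 1"

text \<open>
  The box is required to have side \<open>n > 0\<close>: for \<open>n = 0\<close> it is empty and reduction modulo
  \<open>n\<close> has no representative in it.
\<close>

definition rokhlin_dim_le ::
  "'a::unital_cstar_algebra set \<Rightarrow> (int ^ 'm \<Rightarrow> 'a \<Rightarrow> 'a) \<Rightarrow> nat \<Rightarrow> bool" where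
  "rokhlin_dim_le S \<alpha> d \<longleftrightarrow>
     (\<forall>F \<epsilon> n. finite F \<and> F \<subseteq> S \<and> \<epsilon> > 0 \<and> n > 0 \<longrightarrow>
        (\<exists>f :: nat \<Rightarrow> int ^ 'm \<Rightarrow> 'a.
           (\<forall>l\<le>d. \<forall>v\<in>rokhlin_box n. positive_contraction_in S (f l v)) \<and>
           (\<forall>l\<le>d. \<forall>v\<in>rokhlin_box n. \<forall>w. norm (\<alpha> w (f l v) - f l (vec_mod (v + w) n)) < \<epsilon>) \<and>
           (\<forall>l\<le>d. \<forall>v\<in>rokhlin_box n. \<forall>v'\<in>rokhlin_box n. v \<noteq> v' \<longrightarrow> norm (f l v * f l v') < \<epsilon>) \<and>
           (\<forall>l\<le>d. \<forall>v\<in>rokhlin_box n. \<forall>a\<in>F. norm (commutator (f l v) a) < \<epsilon>) \<and>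
           norm ((\<Sum>l\<le>d. \<Sum>v\<in>rokhlin_box n. f l v) - 1) < \<epsilon>))"

definition rokhlin_dim ::
  "'a::unital_cstar_algebra set \<Rightarrow> (int ^ 'm \<Rightarrow> 'a \<Rightarrow> 'a) \<Rightarrow> enat" where
  "rokhlin_dim S \<alpha> =
     (if \<exists>d. rokhlin_dim_le S \<alpha> d then enat (LEAST d. rokhlin_dim_le S \<alpha> d) else \<infinity>)"

end

theory Submission imports Defs begin

text \<open>
  A Rokhlin tower for \<open>\<alpha>\<close> on \<open>B\<close> has all the required properties in the whole algebra except that
  its elements need not almost commute with a given finite subset \<open>F\<close>. Asymptotic commutativity
  repairs this: once the tower \<open>f\<close> is chosen, some \<open>u\<close> makes every \<open>\<alpha> u (f l v)\<close> almost commute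
  with \<open>F\<close>. What remains is that the moved tower is still a Rokhlin tower.

  The usual argument for this is that \<open>*\<close>-automorphisms are isometric. The proof here avoids that
  theorem, which rests on spectral theory, and uses only the first tower condition: it says that
  \<open>\<alpha> u (f l v)\<close> lies within \<open>\<delta>\<close> of \<open>f l (v + u mod n)\<close>. The moved tower is thus a small
  perturbation of the old tower with its levels permuted by a translation of the box, and a
  translation preserves orthogonality between levels and the total sum. The perturbation may push
  norms up to \<open>1 + \<delta>\<close>; dividing by \<open>1 + \<delta>\<close> restores contractions at the price of a further
  error of at most \<open>\<delta>\<close>. Hence \<open>g l v = \<alpha> u (f l v) / (1 + \<delta>)\<close> satisfies all tower conditions up to a
  multiple of \<open>\<delta>\<close> that depends only on the number of tower elements.
\<close>

section \<open>Translations of the box\<close>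

lemma finite_rokhlin_box: "finite (rokhlin_box n :: (int ^ 'm) set)"
proof (rule finite_imageD)
  show "finite (vec_nth ` (rokhlin_box n :: (int ^ 'm) set))"
  proof (rule finite_subset)
    show "vec_nth ` (rokhlin_box n :: (int ^ 'm) set) \<subseteq> Pi\<^sub>E UNIV (\<lambda>_. {0..<int n})"
      by (auto simp: rokhlin_box_def)
  qed (auto intro: finite_PiE)
  show "inj_on vec_nth (rokhlin_box n :: (int ^ 'm) set)"
    by (auto intro: inj_onI simp: vec_nth_inject)
qed

lemma vec_mod_in_box: "n > 0 \<Longrightarrow> vec_mod v n \<in> rokhlin_box n"
  by (simp add: vec_mod_def rokhlin_box_def)

lemma vec_mod_of_box: "v \<in> rokhlin_box n \<Longrightarrow> vec_mod v n = v"
  by (simp add: vec_mod_def rokhlin_box_def vec_eq_iff)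

lemma vec_mod_add_left: "vec_mod (vec_mod v n + w) n = vec_mod (v + w) n"
  by (simp add: vec_mod_def vec_eq_iff mod_simps)

lemma bij_betw_translate_box:
  assumes "n > 0"
  shows "bij_betw (\<lambda>v. vec_mod (v + u) n) (rokhlin_box n) (rokhlin_box n)"
proof (rule bij_betw_byWitness[where f' = "\<lambda>v. vec_mod (v - u) n"])
  have "vec_mod (vec_mod v n - u) n = vec_mod (v - u) n" for v :: "int ^ 'a"
    using vec_mod_add_left[of v n "- u"] by simp
  then show "\<forall>v\<in>rokhlin_box n. vec_mod (vec_mod (v + u) n - u) n = v"
    by (simp add: vec_mod_of_box)
  show "\<forall>v\<in>rokhlin_box n. vec_mod (vec_mod (v - u) n + u) n = v"
    by (simp add: vec_mod_add_left vec_mod_of_box)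
qed (use assms in \<open>auto intro: vec_mod_in_box\<close>)

section \<open>Automorphisms and positive contractions\<close>

lemma star_scaleR: "star (r *\<^sub>R x :: 'a::cstar_algebra) = r *\<^sub>R star x"
  by (metis complex_cnj_complex_of_real scaleC_of_real star_scaleC)

lemma star_automorphism_scaleR:
  "star_automorphism \<phi> \<Longrightarrow> \<phi> (r *\<^sub>R x) = r *\<^sub>R \<phi> x"
  unfolding star_automorphism_def by (metis scaleC_of_real)

lemma commutator_scaleR_left:
  fixes x y :: "'a::cstar_algebra"
  shows "commutator (r *\<^sub>R x) y = r *\<^sub>R commutator x y"
  by (simp add: commutator_def scaleR_diff_right)

text \<open>
  If \<open>f = star g * g\<close>, then \<open>sqrt r *\<^sub>R \<phi> g\<close> witnesses the positivity of \<open>r *\<^sub>R \<phi> f\<close>. The norm bound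
  is a hypothesis on the rescaled image: the tower conditions supply it, in place of the
  isometry of \<open>\<phi>\<close>.
\<close>

lemma positive_contraction_scaled_image:
  assumes "star_automorphism \<phi>" "positive_contraction_in S f"
    and "r \<ge> 0" "norm (r *\<^sub>R \<phi> f) \<le> 1"
  shows "positive_contraction_in UNIV (r *\<^sub>R \<phi> f)"
proof -
  obtain g where "f = star g * g"
    using assms(2) unfolding positive_contraction_in_def by blast
  then have "\<phi> f = star (\<phi> g) * \<phi> g"
    using assms(1) unfolding star_automorphism_def by metis
  then have "r *\<^sub>R \<phi> f = star (sqrt r *\<^sub>R \<phi> g) * (sqrt r *\<^sub>R \<phi> g)"
    using \<open>r \<ge> 0\<close> by (simp add: star_scaleR)
  then show ?thesis
    using assms(4) unfolding positive_contraction_in_def by blast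
qed

section \<open>Moving a tower by the action\<close>

lemma norm_mult_perturb:
  fixes x y x' y' :: "'a::real_normed_algebra"
  assumes "norm (x - x') \<le> e" "norm (y - y') \<le> e" "norm y \<le> 1" "norm x' \<le> 1"
  shows "norm (x * y) \<le> norm (x' * y') + 2 * e"
proof -
  have "x * y = x' * y' + ((x - x') * y + x' * (y - y'))"
    by (simp add: algebra_simps)
  then have "norm (x * y) \<le> norm (x' * y') + (norm ((x - x') * y) + norm (x' * (y - y')))"
    by (metis add_left_mono norm_triangle_ineq order_trans)
  moreover have "norm ((x - x') * y) \<le> e * 1"
    using assms by (intro order_trans[OF norm_mult_ineq] mult_mono) (auto intro: order_trans[OF norm_ge_zero])
  moreover have "norm (x' * (y - y')) \<le> 1 * e"
    using assms by (intro order_trans[OF norm_mult_ineq] mult_mono) auto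
  ultimately show ?thesis by simp
qed

text \<open>
  One \<open>\<delta>\<close> is the distance from \<open>x\<close> to \<open>y\<close>. The other is the cost of the rescaling: the norm of \<open>x\<close> is
  at most \<open>1 + \<delta>\<close>, and the rescaling removes the fraction \<open>\<delta> / (1 + \<delta>)\<close> of \<open>x\<close>.
\<close>

lemma shrink_near_contraction:
  fixes x y :: "'a::real_normed_vector"
  assumes "norm (x - y) \<le> \<delta>" "norm y \<le> 1"
  shows "norm (inverse (1 + \<delta>) *\<^sub>R x) \<le> 1" "norm (inverse (1 + \<delta>) *\<^sub>R x - y) \<le> 2 * \<delta>"
proof -
  have "\<delta> \<ge> 0" using assms(1) norm_ge_zero order_trans by blast
  have "norm x \<le> 1 + \<delta>"
    using assms norm_triangle_sub[of x y] by linarith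
  then show 1: "norm (inverse (1 + \<delta>) *\<^sub>R x) \<le> 1"
    using \<open>\<delta> \<ge> 0\<close> by (simp add: field_simps)
  have "inverse (1 + \<delta>) *\<^sub>R x - x = - \<delta> *\<^sub>R inverse (1 + \<delta>) *\<^sub>R x"
  proof -
    have "x = ((1 + \<delta>) * inverse (1 + \<delta>)) *\<^sub>R x" using \<open>\<delta> \<ge> 0\<close> by simp
    then show ?thesis by (simp add: algebra_simps)
  qed
  then have "norm (inverse (1 + \<delta>) *\<^sub>R x - x) = \<delta> * norm (inverse (1 + \<delta>) *\<^sub>R x)"
    using \<open>\<delta> \<ge> 0\<close> by simp
  also have "\<dots> \<le> \<delta>"
    using 1 \<open>\<delta> \<ge> 0\<close> by (metis mult.right_neutral mult_left_mono)
  finally show "norm (inverse (1 + \<delta>) *\<^sub>R x - y) \<le> 2 * \<delta>"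
    using assms(1) norm_triangle_ineq[of "inverse (1 + \<delta>) *\<^sub>R x - x" "x - y"] by simp
qed

text \<open>
  The order of choices matters: \<open>u\<close> depends on the tower \<open>f\<close>, because asymptotic commutativity is
  applied to the finite set formed by \<open>F\<close> and all elements of \<open>f\<close>.
\<close>

lemma rokhlin_dim_le_UNIV:
  fixes \<alpha> :: "int ^ 'm \<Rightarrow> 'a::unital_cstar_algebra \<Rightarrow> 'a"
  assumes act: "zm_action \<alpha>"
    and comm: "asymptotically_commutative \<alpha>"
    and le: "rokhlin_dim_le B (restricted_action \<alpha> B) d"
  shows "rokhlin_dim_le UNIV \<alpha> d"
  unfolding rokhlin_dim_le_def
proof (intro allI impI, elim conjE)
  fix F :: "'a set" and \<epsilon> :: real and n :: nat
  assume "finite F" "\<epsilon> > 0" "n > 0"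
  let ?box = "rokhlin_box n :: (int ^ 'm) set"
  define N where "N = real (Suc d * card ?box)"
  \<comment> \<open>Orthogonality of the moved tower costs \<open>5 * \<delta>\<close>, the sum over its \<open>N\<close> elements \<open>(2 * N + 1) * \<delta>\<close>.\<close>
  define \<delta> where "\<delta> = \<epsilon> / (2 * N + 5)"
  have "N \<ge> 0" by (simp add: N_def)
  have "\<delta> > 0" using \<open>\<epsilon> > 0\<close> \<open>N \<ge> 0\<close> by (simp add: \<delta>_def)
  have "\<epsilon> = (2 * N + 5) * \<delta>"
    using \<open>N \<ge> 0\<close> by (simp add: \<delta>_def)
  then have "\<epsilon> = 2 * N * \<delta> + 5 * \<delta>"
    by (simp add: distrib_right)
  moreover have "N * \<delta> \<ge> 0" using \<open>N \<ge> 0\<close> \<open>\<delta> > 0\<close> by simp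
  ultimately have \<epsilon>: "5 * \<delta> \<le> \<epsilon>" "2 * N * \<delta> + \<delta> < \<epsilon>" using \<open>\<delta> > 0\<close> by auto

  \<comment> \<open>The finite set is empty here: commutation with \<open>F\<close> comes afterwards, from the choice of \<open>u\<close>.\<close>
  have "finite {} \<and> {} \<subseteq> B \<and> \<delta> > 0 \<and> n > 0"
    using \<open>\<delta> > 0\<close> \<open>n > 0\<close> by simp
  from le[unfolded rokhlin_dim_le_def, THEN spec, THEN spec, THEN spec, THEN mp, OF this]
  obtain f where f:
    "\<forall>l\<le>d. \<forall>v\<in>?box. positive_contraction_in B (f l v)"
    "\<forall>l\<le>d. \<forall>v\<in>?box. \<forall>w.
       norm (restricted_action \<alpha> B w (f l v) - f l (vec_mod (v + w) n)) < \<delta>"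
    "\<forall>l\<le>d. \<forall>v\<in>?box. \<forall>v'\<in>?box. v \<noteq> v' \<longrightarrow> norm (f l v * f l v') < \<delta>"
    and sum1: "norm ((\<Sum>l\<le>d. \<Sum>v\<in>?box. f l v) - 1) < \<delta>"
    by (elim exE conjE)
  have pos: "positive_contraction_in B (f l v)" if "l \<le> d" "v \<in> ?box" for l v
    using f(1) that by blast
  have equiv_B: "norm (restricted_action \<alpha> B w (f l v) - f l (vec_mod (v + w) n)) < \<delta>"
    if "l \<le> d" "v \<in> ?box" for l v w
    using f(2) that by blast
  have orth: "norm (f l v * f l v') < \<delta>"
    if "l \<le> d" "v \<in> ?box" "v' \<in> ?box" "v \<noteq> v'" for l v v'
    using f(3) that by blast
  have f_norm: "norm (f l v) \<le> 1" if "l \<le> d" "v \<in> ?box" for l v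
    using pos[OF that] by (simp add: positive_contraction_in_def)
  have equiv: "norm (\<alpha> w (f l v) - f l (vec_mod (v + w) n)) < \<delta>"
    if "l \<le> d" "v \<in> ?box" for l v w
    using equiv_B[OF that, of w] pos[OF that]
    by (simp add: restricted_action_def positive_contraction_in_def)

  have "finite (F \<union> (\<Union>l\<in>{..d}. f l ` ?box))"
    using \<open>finite F\<close> finite_rokhlin_box by blast
  then obtain u where u: "\<And>x y. x \<in> F \<union> (\<Union>l\<in>{..d}. f l ` ?box) \<Longrightarrow>
      y \<in> F \<union> (\<Union>l\<in>{..d}. f l ` ?box) \<Longrightarrow> norm (commutator (\<alpha> u x) y) < \<delta>"
    using comm \<open>\<delta> > 0\<close> unfolding asymptotically_commutative_def by meson
  have aut: "star_automorphism (\<alpha> w)" for w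
    using act by (simp add: zm_action_def)

  define r where "r = inverse (1 + \<delta>)"
  have r: "0 \<le> r" "r \<le> 1" using \<open>\<delta> > 0\<close> by (auto simp: r_def inverse_le_1_iff)
  have r_scale: "norm (r *\<^sub>R x) \<le> norm x" for x :: 'a
    using r by (simp add: mult_left_le_one_le)
  define \<tau> where "\<tau> v = vec_mod (v + u) n" for v
  define g where "g l v = r *\<^sub>R \<alpha> u (f l v)" for l v
  have \<tau>_box: "\<tau> v \<in> ?box" for v
    using \<open>n > 0\<close> by (simp add: \<tau>_def vec_mod_in_box)
  have \<tau>_bij: "bij_betw \<tau> ?box ?box"
    using bij_betw_translate_box[OF \<open>n > 0\<close>, of u] by (simp add: \<tau>_def[abs_def])
  have near: "norm (\<alpha> u (f l v) - f l (\<tau> v)) \<le> \<delta>" if "l \<le> d" "v \<in> ?box" for l v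
    using equiv[OF that, of u] by (simp add: \<tau>_def)
  have g_norm: "norm (g l v) \<le> 1"
    and g_near: "norm (g l v - f l (\<tau> v)) \<le> 2 * \<delta>" if "l \<le> d" "v \<in> ?box" for l v
    using shrink_near_contraction[OF near[OF that] f_norm[OF that(1) \<tau>_box]]
    by (simp_all add: g_def r_def)

  have "positive_contraction_in UNIV (g l v)" if "l \<le> d" "v \<in> ?box" for l v
    using positive_contraction_scaled_image[OF aut pos[OF that] r(1)] g_norm[OF that]
    by (simp add: g_def)
  moreover have "norm (\<alpha> w (g l v) - g l (vec_mod (v + w) n)) < \<epsilon>"
    if "l \<le> d" "v \<in> ?box" for l v w
  proof -
    \<comment> \<open>Both terms are close to the tower element at \<open>v + w + u mod n\<close>.\<close>
    let ?p = "f l (vec_mod (v + (w + u)) n)"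
    have "\<alpha> w (\<alpha> u (f l v)) = \<alpha> (w + u) (f l v)"
      using act by (simp add: zm_action_def)
    then have 1: "norm (\<alpha> w (\<alpha> u (f l v)) - ?p) < \<delta>"
      using equiv[OF that, of "w + u"] by simp
    have 2: "norm (\<alpha> u (f l (vec_mod (v + w) n)) - ?p) < \<delta>"
      using equiv[OF that(1) vec_mod_in_box[OF \<open>n > 0\<close>], of u "v + w"]
      by (simp add: vec_mod_add_left add.assoc)
    have "\<alpha> w (g l v) - g l (vec_mod (v + w) n)
        = r *\<^sub>R (\<alpha> w (\<alpha> u (f l v)) - \<alpha> u (f l (vec_mod (v + w) n)))"
      by (simp add: g_def star_automorphism_scaleR[OF aut] scaleR_diff_right)
    then have "norm (\<alpha> w (g l v) - g l (vec_mod (v + w) n))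
        \<le> norm (\<alpha> w (\<alpha> u (f l v)) - \<alpha> u (f l (vec_mod (v + w) n)))"
      using r_scale by metis
    also have "\<dots> < 2 * \<delta>"
      using norm_triangle_ineq4[of "\<alpha> w (\<alpha> u (f l v)) - ?p" "\<alpha> u (f l (vec_mod (v + w) n)) - ?p"] 1 2
      by simp
    finally show ?thesis using \<epsilon> \<open>\<delta> > 0\<close> by linarith
  qed
  moreover have "norm (g l v * g l v') < \<epsilon>"
    if "l \<le> d" "v \<in> ?box" "v' \<in> ?box" "v \<noteq> v'" for l v v'
  proof -
    have "\<tau> v \<noteq> \<tau> v'"
      using \<tau>_bij that by (auto simp: bij_betw_def inj_on_def)
    then have "norm (f l (\<tau> v) * f l (\<tau> v')) < \<delta>"
      using orth that(1) \<tau>_box by blast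
    then show ?thesis
      using norm_mult_perturb[OF g_near[OF that(1,2)] g_near[OF that(1,3)] g_norm[OF that(1,3)]
          f_norm[OF that(1) \<tau>_box]] \<epsilon> by linarith
  qed
  moreover have "norm (commutator (g l v) a) < \<epsilon>" if "l \<le> d" "v \<in> ?box" "a \<in> F" for l v a
  proof -
    have "norm (commutator (g l v) a) \<le> norm (commutator (\<alpha> u (f l v)) a)"
      using r_scale by (simp add: g_def commutator_scaleR_left del: norm_scaleR)
    also have "\<dots> < \<delta>"
      using that by (intro u) auto
    finally show ?thesis using \<epsilon> \<open>\<delta> > 0\<close> by linarith
  qed
  moreover have "norm ((\<Sum>l\<le>d. \<Sum>v\<in>?box. g l v) - 1) < \<epsilon>"
  proof -
    have "(\<Sum>v\<in>?box. f l (\<tau> v)) = (\<Sum>v\<in>?box. f l v)" for l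
      using sum.reindex_bij_betw[OF \<tau>_bij] by blast
    then have "(\<Sum>l\<le>d. \<Sum>v\<in>?box. g l v) - (\<Sum>l\<le>d. \<Sum>v\<in>?box. f l v)
        = (\<Sum>l\<le>d. \<Sum>v\<in>?box. g l v - f l (\<tau> v))"
      by (simp add: sum_subtractf)
    moreover have "norm (\<Sum>l\<le>d. \<Sum>v\<in>?box. g l v - f l (\<tau> v)) \<le> (\<Sum>l\<le>d. \<Sum>v\<in>?box. 2 * \<delta>)"
      by (intro sum_norm_le) (auto intro: g_near)
    moreover have "(\<Sum>l\<le>d. \<Sum>v\<in>?box. 2 * \<delta>) = 2 * N * \<delta>"
      by (simp add: N_def algebra_simps)
    ultimately have "norm ((\<Sum>l\<le>d. \<Sum>v\<in>?box. g l v) - (\<Sum>l\<le>d. \<Sum>v\<in>?box. f l v)) \<le> 2 * N * \<delta>"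
      by metis
    then show ?thesis
      using sum1 \<epsilon>(2) norm_triangle_ineq[of "(\<Sum>l\<le>d. \<Sum>v\<in>?box. g l v) - (\<Sum>l\<le>d. \<Sum>v\<in>?box. f l v)"
          "(\<Sum>l\<le>d. \<Sum>v\<in>?box. f l v) - 1"] by simp
  qed
  ultimately show "\<exists>f :: nat \<Rightarrow> int ^ 'm \<Rightarrow> 'a.
      (\<forall>l\<le>d. \<forall>v\<in>?box. positive_contraction_in UNIV (f l v)) \<and>
      (\<forall>l\<le>d. \<forall>v\<in>?box. \<forall>w. norm (\<alpha> w (f l v) - f l (vec_mod (v + w) n)) < \<epsilon>) \<and>
      (\<forall>l\<le>d. \<forall>v\<in>?box. \<forall>v'\<in>?box. v \<noteq> v' \<longrightarrow> norm (f l v * f l v') < \<epsilon>) \<and>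
      (\<forall>l\<le>d. \<forall>v\<in>?box. \<forall>a\<in>F. norm (commutator (f l v) a) < \<epsilon>) \<and>
      norm ((\<Sum>l\<le>d. \<Sum>v\<in>?box. f l v) - 1) < \<epsilon>"
    by (intro exI[of _ g]) blast
qed

lemma rokhlin_dim_mono:
  assumes "\<And>d. rokhlin_dim_le T \<beta> d \<Longrightarrow> rokhlin_dim_le S \<alpha> d"
  shows "rokhlin_dim S \<alpha> \<le> rokhlin_dim T \<beta>"
proof (cases "\<exists>d. rokhlin_dim_le T \<beta> d")
  case True
  then have "rokhlin_dim_le S \<alpha> (LEAST d. rokhlin_dim_le T \<beta> d)"
    using assms LeastI_ex by metis
  then show ?thesis
    using True by (auto simp: rokhlin_dim_def intro: Least_le)
qed (simp add: rokhlin_dim_def)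

section \<open>Comparison of Rokhlin dimensions\<close>

theorem proposition6p3:
  fixes \<alpha> :: "int ^ 'm \<Rightarrow> 'a::unital_cstar_algebra \<Rightarrow> 'a"
    and B :: "'a set"
  assumes "zm_action \<alpha>"
    and "cstar_subalgebra B"
    and "1 \<in> B"
    and "invariant_under \<alpha> B"
    and "asymptotically_commutative \<alpha>"
  shows "rokhlin_dim UNIV \<alpha> \<le> rokhlin_dim B (restricted_action \<alpha> B)"
  by (rule rokhlin_dim_mono) (rule rokhlin_dim_le_UNIV[OF assms(1,5)])

end
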